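(* Let $N\ge2$, let $G=(V,E)$, the positive edge weights $e_{r,s},\dot e_{r,s}$, the probability distribution on the set $\mathcal T$ of spanning trees, and the random variables $P^{r,s}g_{k,l}$ and $T_{r,s}g_{k,l}$ be as in the context. Let $(f_{r,s})_{(r,s)\in V}$ be positive with $$\frac1{f_{r,s}}=\frac{e_{r+1,s}}{e_{r+1,s}+\dot e_{r+1,s}}\frac1{f_{r+1,s}}+\frac{\dot e_{r,s+1}}{e_{r,s+1}+\dot e_{r,s+1}}\frac1{f_{r,s+1}}\qquad\text{for all }1<r+s<N.$$ For any positive sequence $(\bar c_{r,s})_{(r,s)\in V}$ define $$K=\sup_{(r,s)\in V}\ \mathbb E\Big[P^{r,s}\frac1{f_{k,l}\bar c_{k,l}}\Big]\cdot f_{r,s}\,\mathbb E\big[T_{r,s}\bar c_{k,l}\big].$$ Then for any sequence $u_{r,s}\ge0$, $(r,s)\in V$, with $u_{1,0}=u_{0,1}=1$, $$\sum_{2\le r+s\le N}\bar c_{r,s}\Psi(u_{r,s})\le4K\sum_{2\le r+s\le N}\bar c_{r,s}\left(\frac{e_{r,s}}{e_{r,s}+\dot e_{r,s}}\Big(\sqrt{\Psi(u_{r,s})}-\sqrt{\Psi(u_{r-1,s})}\Big)^2+\frac{\dot e_{r,s}}{e_{r,s}+\dot e_{r,s}}\Big(\sqrt{\Psi(u_{r,s})}-\sqrt{\Psi(u_{r,s-1})}\Big)^2\right).$$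
   Context: $\Psi(x)=x\ln x+1-x$ for $x\ge 0$, $\Psi(0)=1$. Directed graph $G=(V,E)$: $V=\{(r,s)\in\mathbb N_0^2:1\le r+s\le N\}$, and $E$ consists of all edges $((r,s),(r+1,s))$ and $((r,s),(r,s+1))$ with $(r,s)\in V$, $r+s<N$. Given positive edge weights $e:E\to\mathbb R_{>0}$ write $e_{r,s}=e((r-1,s),(r,s))$ and $\dot e_{r,s}=e((r,s-1),(r,s))$, with the convention $e_{0,s}=0=\dot e_{r,0}$; terms multiplied by $0$ are $0$ even if another factor is undefined. $\mathcal T$ is the set of (directed) spanning trees of $G$ after the two nodes $(1,0)$ and $(0,1)$ have been fused to a single root; equivalently, a tree is given by choosing for every node $(r,s)$ with $r+s\ge2$ exactly one incoming edge. Each tree $T$ gets probability proportional to $\nu(T)=\prod_{f\in E(T)}e(f)$; $\mathbb E$ is the corresponding expectation. For $T\in\mathcal T$: $P^{r,s}(T)$ is the unique path in $T$ from the root to $(r,s)$, and $T_{r,s}(T)$ is the subtree of $T$ rooted at $(r,s)$, i.e. $(r,s)$ together with all its descendants. For $g:V\to\mathbb R$, $P^{r,s}g_{k,l}(T)$ is the sum of $g_w$ over all edges $(v,w)$ of $P^{r,s}(T)$ (so it is $0$ for $r+s=1$), and $T_{r,s}g_{k,l}(T)=\sum_{(k,l)\in T_{r,s}(T)}g_{k,l}$. For $r+s=1$ the product in the supremum defining $K$ is $0$. *)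

theory Defs
  imports "HOL-Probability.Probability" "Graph_Theory.Graph_Theory"
begin

type_synonym node = "nat \<times> nat"
type_synonym edge = "node \<times> node"

text \<open>At \<open>x = 0\<close> this has the value \<open>1\<close>, since \<open>0 * ln 0 = 0\<close>.\<close>

definition Psi :: "real \<Rightarrow> real" where
  "Psi x = x * ln x + 1 - x"

definition nodes :: "nat \<Rightarrow> node set" where
  "nodes N = {(r, s). 1 \<le> r + s \<and> r + s \<le> N}"

definition edges :: "nat \<Rightarrow> edge set" where
  "edges N = {((r, s), (r + 1, s)) | r s. (r, s) \<in> nodes N \<and> r + s < N}
           \<union> {((r, s), (r, s + 1)) | r s. (r, s) \<in> nodes N \<and> r + s < N}"

text \<open>The weight of the edge entering \<open>(r, s)\<close> from \<open>(r - 1, s)\<close>, resp. from \<open>(r, s - 1)\<close>.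
  Products containing a factor that is zero by the first clause also mention values such as
  \<open>u (r - 1, s)\<close> with \<open>r = 0\<close>; natural subtraction makes these well-defined, and they are
  multiplied by zero.\<close>

definition w_left :: "(edge \<Rightarrow> real) \<Rightarrow> nat \<Rightarrow> nat \<Rightarrow> real" where
  "w_left e r s = (if r = 0 then 0 else e ((r - 1, s), (r, s)))"

definition w_down :: "(edge \<Rightarrow> real) \<Rightarrow> nat \<Rightarrow> nat \<Rightarrow> real" where
  "w_down e r s = (if s = 0 then 0 else e ((r, s - 1), (r, s)))"

text \<open>The nodes \<open>(1, 0)\<close> and \<open>(0, 1)\<close> are fused to a single root. The root is represented by
  \<open>(0, 0)\<close>, which is not a node of the original graph. The arcs of the fused (multi-)digraph are
  the original edges, so the two edges into \<open>(1, 1)\<close> become parallel arcs that are still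
  distinct. For a set \<open>T\<close> of edges, \<open>fused_graph N T\<close> is the spanning subgraph with
  arcs \<open>T\<close>.\<close>

definition root_node :: node where
  "root_node = (0, 0)"

definition fuse :: "node \<Rightarrow> node" where
  "fuse v = (if v = (1, 0) \<or> v = (0, 1) then root_node else v)"

definition fused_graph :: "nat \<Rightarrow> edge set \<Rightarrow> (node, edge) pre_digraph" where
  "fused_graph N T =
     \<lparr>verts = fuse ` nodes N, arcs = T, tail = (\<lambda>a. fuse (fst a)), head = (\<lambda>a. fuse (snd a))\<rparr>"

text \<open>Directed spanning trees of the fused graph, as edge sets: from the root there is exactly one
  directed walk to each vertex.\<close>

definition spanning_trees :: "nat \<Rightarrow> edge set set" where
  "spanning_trees N = {T. T \<subseteq> edges N \<and>
     (\<forall>v \<in> verts (fused_graph N T). \<exists>!p. pre_digraph.awalk (fused_graph N T) root_node p v)}"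

definition tree_path :: "nat \<Rightarrow> edge set \<Rightarrow> node \<Rightarrow> edge list" where
  "tree_path N T v = (THE p. pre_digraph.awalk (fused_graph N T) root_node p (fuse v))"

definition subtree :: "nat \<Rightarrow> edge set \<Rightarrow> node \<Rightarrow> node set" where
  "subtree N T v = {w \<in> nodes N. fuse v \<rightarrow>\<^sup>*\<^bsub>fused_graph N T\<^esub> fuse w}"

text \<open>The random variables \<open>P g\<close> and \<open>T g\<close> at the node \<open>v\<close>, as functions of the tree (each edge of the path contributes the value of \<open>g\<close> at its
  endpoint, so the root contributes nothing to \<open>P g\<close>).\<close>

definition path_sum :: "nat \<Rightarrow> node \<Rightarrow> (node \<Rightarrow> real) \<Rightarrow> edge set \<Rightarrow> real" where
  "path_sum N v g T = (\<Sum>a \<leftarrow> tree_path N T v. g (snd a))"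

definition subtree_sum :: "nat \<Rightarrow> node \<Rightarrow> (node \<Rightarrow> real) \<Rightarrow> edge set \<Rightarrow> real" where
  "subtree_sum N v g T = (\<Sum>w \<in> subtree N T v. g w)"

definition tree_weight :: "(edge \<Rightarrow> real) \<Rightarrow> edge set \<Rightarrow> real" where
  "tree_weight e T = (\<Prod>a \<in> T. e a)"

definition tree_measure :: "nat \<Rightarrow> (edge \<Rightarrow> real) \<Rightarrow> edge set measure" where
  "tree_measure N e = point_measure (spanning_trees N)
     (\<lambda>T. ennreal (tree_weight e T / (\<Sum>S \<in> spanning_trees N. tree_weight e S)))"

end

theory Submission
  imports Defs
begin

text \<open>
  Choosing a random spanning tree amounts to choosing one incoming edge at every node
  independently, so the path to a node is the trajectory of a Markov chain with kernel \<open>P\<close> that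
  steps from a node to its parent. Let \<open>G v w\<close> be the probability that \<open>w\<close> lies on the path
  to \<open>v\<close>, let \<open>S\<close> and \<open>M\<close> be the two expectations in \<open>K\<close>, and let \<open>D v\<close> be the mean squared
  increment of \<open>x = sqrt (Psi u)\<close> at \<open>v\<close>.

  As in Muckenhoupt's proof of Hardy's inequality, the Cauchy-Schwarz inequality with the weight
  \<open>f c sqrt S\<close> gives \<open>(x v)\<^sup>2 \<le> 2 sqrt (S v) (\<Sum>w. G v w (D w c w f w sqrt (S w)))\<close>, because
  \<open>S v - P S v = 1 / (f v c v)\<close> and the square root is concave. After summation against \<open>c\<close> and
  exchange of sums it remains to bound \<open>\<Sum>v. c v sqrt (S v) G v w\<close>. Since \<open>S f M \<le> K\<close> and \<open>1 / f\<close>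
  is superharmonic for the transpose of \<open>P\<close>, the same concavity argument for the chain running forward,
  with \<open>f M\<close> instead of \<open>S\<close>, bounds it by \<open>2 sqrt K sqrt (f w M w) / f w\<close>.
\<close>

section \<open>A Hardy inequality for substochastic kernels\<close>

text \<open>Cauchy-Schwarz for the vectors \<open>sqrt (p w * s w)\<close> and
  \<open>sqrt (p w * t w)\<close>. With \<open>s = 1\<close> and total mass at most 1 it is the
  concavity of the square root.\<close>

lemma sum_mult_sqrt_le:
  fixes p t :: "'a \<Rightarrow> real"
  assumes "\<And>w. w \<in> V \<Longrightarrow> 0 \<le> p w" "\<And>w. w \<in> V \<Longrightarrow> 0 \<le> s w" "\<And>w. w \<in> V \<Longrightarrow> 0 \<le> t w"
  shows "(\<Sum>w\<in>V. p w * sqrt (s w * t w)) \<le> sqrt ((\<Sum>w\<in>V. p w * s w) * (\<Sum>w\<in>V. p w * t w))"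
proof -
  have "(\<Sum>w\<in>V. p w * sqrt (s w * t w)) = (\<Sum>w\<in>V. sqrt (p w * s w) * sqrt (p w * t w))"
    using assms by (intro sum.cong) (auto simp: real_sqrt_mult)
  also have "\<dots>\<^sup>2 \<le> (\<Sum>w\<in>V. (sqrt (p w * s w))\<^sup>2) * (\<Sum>w\<in>V. (sqrt (p w * t w))\<^sup>2)"
    by (rule Cauchy_Schwarz_ineq_sum)
  also have "\<dots> = (\<Sum>w\<in>V. p w * s w) * (\<Sum>w\<in>V. p w * t w)"
    using assms by (intro arg_cong2[where f = "(*)"] sum.cong) auto
  finally show ?thesis
    by (intro real_le_rsqrt)
qed

text \<open>The two-term case with unit weights, used to join the contribution of a node to the
  average over its parents.\<close>

lemma sqrt_mult_add_le:
  fixes a b A B :: real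
  assumes "0 \<le> a" "0 \<le> b" "0 \<le> A" "0 \<le> B"
  shows "sqrt (a * b) + sqrt (A * B) \<le> sqrt ((a + A) * (b + B))"
  using sum_mult_sqrt_le[of "UNIV :: bool set" "\<lambda>_. 1" "\<lambda>i. if i then a else A" "\<lambda>i. if i then b else B"]
    assms by (simp add: UNIV_bool add.commute)

text \<open>The discrete counterpart of \<open>(2 sqrt S)' = S' / sqrt S\<close>.\<close>

lemma sqrt_increment:
  fixes p t :: "'a \<Rightarrow> real"
  assumes p: "\<And>w. w \<in> V \<Longrightarrow> 0 \<le> p w" "(\<Sum>w\<in>V. p w) \<le> 1"
    and t: "\<And>w. w \<in> V \<Longrightarrow> 0 \<le> t w"
    and g: "s = g + (\<Sum>w\<in>V. p w * t w)" "0 < s"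
  shows "g / sqrt s + (\<Sum>w\<in>V. p w * (2 * sqrt (t w))) \<le> 2 * sqrt s"
proof -
  define r where "r = (\<Sum>w\<in>V. p w * t w)"
  have r0: "0 \<le> r" unfolding r_def using p t by (intro sum_nonneg) auto
  have "(\<Sum>w\<in>V. p w * sqrt (1 * t w)) \<le> sqrt ((\<Sum>w\<in>V. p w * 1) * r)"
    unfolding r_def using p t by (intro sum_mult_sqrt_le) auto
  also have "\<dots> \<le> sqrt (1 * r)"
    using p r0 by (intro real_sqrt_le_mono mult_right_mono) auto
  finally have 1: "(\<Sum>w\<in>V. p w * sqrt (t w)) \<le> sqrt r" by simp
  define y z where "y = sqrt r" and "z = sqrt s"
  have z: "0 < z" "g = z * z - y * y" "0 \<le> y"
    using g r0 by (auto simp: y_def z_def r_def)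
  have "g / z + 2 * y \<le> 2 * z"
  proof -
    \<comment> \<open>Since \<open>g\<close> is a difference of squares, this is
      \<open>(z - y)^2 \<ge> 0\<close>.\<close>
    have "g + 2 * y * z \<le> 2 * z * z"
      using zero_le_power2[of "z - y"] unfolding z(2) by (simp add: power2_eq_square algebra_simps)
    then show ?thesis using z(1) by (simp add: field_simps)
  qed
  moreover have "(\<Sum>w\<in>V. p w * (2 * sqrt (t w))) = 2 * (\<Sum>w\<in>V. p w * sqrt (t w))"
    by (simp add: sum_distrib_left mult_ac)
  ultimately show ?thesis using 1 unfolding y_def z_def by linarith
qed

text \<open>\<open>G\<close> is the Green function, the sum of all powers of \<open>P\<close>. As
  \<open>P\<close> strictly lowers \<open>rank\<close>, it is nilpotent, so no convergence question
  arises and \<open>G_step\<close> determines \<open>G\<close>. Row sums below 1 allow for a chain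
  that is killed on leaving \<open>V\<close>.\<close>

locale green_kernel =
  fixes V :: "'a set" and rank :: "'a \<Rightarrow> nat" and P G :: "'a \<Rightarrow> 'a \<Rightarrow> real"
  assumes finite_V: "finite V"
    and P_nonneg: "\<And>v w. v \<in> V \<Longrightarrow> w \<in> V \<Longrightarrow> 0 \<le> P v w"
    and P_substochastic: "\<And>v. v \<in> V \<Longrightarrow> (\<Sum>w\<in>V. P v w) \<le> 1"
    and P_rank: "\<And>v w. v \<in> V \<Longrightarrow> w \<in> V \<Longrightarrow> P v w \<noteq> 0 \<Longrightarrow> rank w < rank v"
    and G_step: "\<And>v w. v \<in> V \<Longrightarrow> w \<in> V \<Longrightarrow> G v w = of_bool (v = w) + (\<Sum>x\<in>V. P v x * G x w)"
begin

section \<open>Green function and potentials\<close>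

lemma G_nonneg: "v \<in> V \<Longrightarrow> w \<in> V \<Longrightarrow> 0 \<le> G v w"
proof (induction v rule: measure_induct_rule[of rank])
  case (less v)
  have "0 \<le> P v x * G x w" if "x \<in> V" for x
    using less.IH[of x] less.prems P_nonneg[of v x] P_rank[of v x] that
    by (cases "P v x = 0") auto
  then show ?case
    using less.prems by (subst G_step) (auto intro!: add_nonneg_nonneg sum_nonneg)
qed

text \<open>\<open>G = I + P G\<close> decomposes at the first step; the decomposition
  \<open>G = I + G P\<close> at the last step is needed for sums over the starting point. The
  induction hypothesis is inserted into \<open>P G\<close>, and \<open>P G = G - I\<close> is then
  used a second time.\<close>

lemma G_step_right:
  "v \<in> V \<Longrightarrow> w \<in> V \<Longrightarrow> G v w = of_bool (v = w) + (\<Sum>z\<in>V. G v z * P z w)"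
proof (induction v rule: measure_induct_rule[of rank])
  case (less v)
  have "G v w = of_bool (v = w) + (\<Sum>x\<in>V. P v x * G x w)"
    using less.prems by (rule G_step)
  also have "(\<Sum>x\<in>V. P v x * G x w) =
      (\<Sum>x\<in>V. P v x * (of_bool (x = w) + (\<Sum>z\<in>V. G x z * P z w)))"
    using less P_rank[of v] by (intro sum.cong) force+
  also have "\<dots> = P v w + (\<Sum>x\<in>V. \<Sum>z\<in>V. P v x * G x z * P z w)"
    using less.prems finite_V by (simp add: algebra_simps sum.distrib sum_distrib_left)
  also have "(\<Sum>x\<in>V. \<Sum>z\<in>V. P v x * G x z * P z w) = (\<Sum>z\<in>V. (\<Sum>x\<in>V. P v x * G x z) * P z w)"
    by (subst sum.swap) (simp add: sum_distrib_right)
  also have "\<dots> = (\<Sum>z\<in>V. (G v z - of_bool (v = z)) * P z w)"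
    using less.prems by (intro sum.cong refl) (simp add: G_step[of v])
  also have "\<dots> = (\<Sum>z\<in>V. G v z * P z w) - P v w"
    using less.prems finite_V by (simp add: algebra_simps sum_subtractf)
  finally show ?case by simp
qed

text \<open>The potential of \<open>a\<close> solves the Poisson equation with source
  \<open>a\<close>.\<close>

lemma potential_step:
  assumes "v \<in> V"
  shows "(\<Sum>w\<in>V. G v w * a w) = a v + (\<Sum>x\<in>V. P v x * (\<Sum>w\<in>V. G x w * a w))"
proof -
  have "(\<Sum>w\<in>V. G v w * a w) = (\<Sum>w\<in>V. of_bool (v = w) * a w + (\<Sum>x\<in>V. P v x * G x w) * a w)"
    using assms by (intro sum.cong refl) (simp add: G_step[of v] algebra_simps)
  also have "\<dots> = a v + (\<Sum>w\<in>V. \<Sum>x\<in>V. P v x * G x w * a w)"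
    using assms finite_V by (simp add: sum.distrib sum_distrib_right)
  also have "(\<Sum>w\<in>V. \<Sum>x\<in>V. P v x * G x w * a w) = (\<Sum>x\<in>V. P v x * (\<Sum>w\<in>V. G x w * a w))"
    by (subst sum.swap) (simp add: sum_distrib_left mult_ac)
  finally show ?thesis .
qed

text \<open>The Poisson equation for the transpose of \<open>P\<close>, by decomposition at the last
  step.\<close>

lemma copotential_step:
  assumes "w \<in> V"
  shows "(\<Sum>v\<in>V. b v * G v w) = b w + (\<Sum>z\<in>V. P z w * (\<Sum>v\<in>V. b v * G v z))"
proof -
  have "(\<Sum>v\<in>V. b v * G v w) = (\<Sum>v\<in>V. of_bool (v = w) * b v + b v * (\<Sum>z\<in>V. G v z * P z w))"
    using assms by (intro sum.cong refl) (simp add: G_step_right[of _ w] algebra_simps)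
  also have "\<dots> = b w + (\<Sum>v\<in>V. \<Sum>z\<in>V. b v * G v z * P z w)"
    using assms finite_V by (simp add: sum.distrib sum_distrib_left mult_ac)
  also have "(\<Sum>v\<in>V. \<Sum>z\<in>V. b v * G v z * P z w) = (\<Sum>z\<in>V. P z w * (\<Sum>v\<in>V. b v * G v z))"
    by (subst sum.swap) (simp add: sum_distrib_left mult_ac)
  finally show ?thesis .
qed

text \<open>Minimality of the potential: as a row vector, \<open>b \<le> h - h P\<close>.
  Multiplying by \<open>G \<ge> 0\<close> from the right and using \<open>(I - P) G = I\<close>
  leaves \<open>h\<close>.\<close>

lemma copotential_le:
  assumes w: "w \<in> V"
    and super: "\<And>v. v \<in> V \<Longrightarrow> b v + (\<Sum>z\<in>V. P z v * h z) \<le> h v"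
  shows "(\<Sum>v\<in>V. b v * G v w) \<le> h w"
proof -
  have "(\<Sum>v\<in>V. b v * G v w) \<le> (\<Sum>v\<in>V. (h v - (\<Sum>z\<in>V. P z v * h z)) * G v w)"
    using super w G_nonneg by (intro sum_mono mult_right_mono) (auto simp: algebra_simps)
  also have "\<dots> = (\<Sum>v\<in>V. h v * G v w) - (\<Sum>v\<in>V. \<Sum>z\<in>V. P z v * h z * G v w)"
    by (simp add: sum_subtractf left_diff_distrib sum_distrib_right)
  also have "(\<Sum>v\<in>V. \<Sum>z\<in>V. P z v * h z * G v w) = (\<Sum>z\<in>V. h z * (\<Sum>v\<in>V. P z v * G v w))"
    by (subst sum.swap) (simp add: sum_distrib_left mult_ac)
  also have "\<dots> = (\<Sum>z\<in>V. h z * G z w - h z * of_bool (z = w))"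
    using w by (intro sum.cong refl) (simp add: G_step[of _ w] algebra_simps)
  also have "\<dots> = (\<Sum>v\<in>V. h v * G v w) - h w"
    using w finite_V by (simp add: sum_subtractf)
  finally show ?thesis by simp
qed

text \<open>The constant 4 is the product of two factors 2, one from \<open>sqrt_increment\<close>
  for \<open>P\<close> and one from \<open>sqrt_increment\<close> for its transpose. Only an
  inequality is asked of \<open>1 / f\<close>, so that nodes without successors are covered.\<close>

theorem hardy_inequality:
  fixes f c S M D x :: "'a \<Rightarrow> real" and K :: real
  assumes f: "\<And>v. v \<in> V \<Longrightarrow> 0 < f v" and c: "\<And>v. v \<in> V \<Longrightarrow> 0 < c v"
    and f_super: "\<And>v. v \<in> V \<Longrightarrow> (\<Sum>z\<in>V. P z v / f z) \<le> 1 / f v"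
    and S_step: "\<And>v. v \<in> V \<Longrightarrow> S v = 1 / (f v * c v) + (\<Sum>w\<in>V. P v w * S w)"
    and M_eq: "\<And>v. v \<in> V \<Longrightarrow> M v = (\<Sum>w\<in>V. c w * G w v)"
    and K: "\<And>v. v \<in> V \<Longrightarrow> S v * (f v * M v) \<le> K"
    and D: "\<And>v. v \<in> V \<Longrightarrow> 0 \<le> D v"
    and x: "\<And>v. v \<in> V \<Longrightarrow> \<bar>x v\<bar> \<le> sqrt (D v) + (\<Sum>w\<in>V. P v w * \<bar>x w\<bar>)"
  shows "(\<Sum>v\<in>V. c v * (x v)\<^sup>2) \<le> 4 * K * (\<Sum>v\<in>V. c v * D v)"
proof -
  have S: "0 < S v" if "v \<in> V" for v
    using that
  proof (induction v rule: measure_induct_rule[of rank])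
    case (less v)
    have "0 \<le> P v w * S w" if "w \<in> V" for w
      using less.IH[of w] less.prems P_nonneg[of v w] P_rank[of v w] that
      by (cases "P v w = 0") auto
    then show ?case
      using less.prems f c by (subst S_step) (auto intro!: add_pos_nonneg sum_nonneg)
  qed
  have M_step: "M v = c v + (\<Sum>z\<in>V. P z v * M z)" if "v \<in> V" for v
    using copotential_step[OF that, of c] that by (simp add: M_eq)
  have M: "0 < M v" if "v \<in> V" for v
  proof -
    have "0 \<le> M z" if "z \<in> V" for z
      using that c G_nonneg unfolding M_eq[OF that]
      by (intro sum_nonneg mult_nonneg_nonneg) (auto intro: less_imp_le)
    then show ?thesis
      using that c P_nonneg by (subst M_step) (auto intro!: add_pos_nonneg sum_nonneg)
  qed
  \<comment> \<open>For empty \<open>V\<close> the hypothesis on \<open>K\<close> is vacuous, so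
    positivity is claimed only in the presence of a node.\<close>
  have K0: "0 < K" if "v \<in> V" for v
    using K[OF that] S[OF that] f[OF that] M[OF that]
    by (meson less_le_trans mult_pos_pos)

  \<comment> \<open>The weight splits \<open>D\<close> into \<open>a * b\<close> with
    \<open>b = 1 / (c f sqrt S)\<close>. This \<open>b\<close> is the source
    \<open>1 / (f c)\<close> of \<open>S\<close> divided by \<open>sqrt S\<close>, so
    \<open>sqrt_increment\<close> makes \<open>2 * sqrt S\<close> a supersolution for the source
    \<open>b\<close>.\<close>
  define a where "a v = D v * (c v * f v * sqrt (S v))" for v
  define A where "A v = (\<Sum>w\<in>V. G v w * a w)" for v
  have a: "0 \<le> a v" if "v \<in> V" for v
    using that D[OF that] f[OF that] c[OF that] S[OF that] by (simp add: a_def)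
  have A: "0 \<le> A v" if "v \<in> V" for v
    using that a G_nonneg by (auto simp: A_def intro!: sum_nonneg)
  have A_step: "A v = a v + (\<Sum>w\<in>V. P v w * A w)" if "v \<in> V" for v
    using potential_step[OF that] by (simp add: A_def)

  \<comment> \<open>Induction on the rank with two uses of Cauchy-Schwarz: one averages the bounds
    at the parents, the other adds the increment \<open>sqrt (a v * b)\<close> at
    \<open>v\<close>.\<close>
  have x_le: "\<bar>x v\<bar> \<le> sqrt (A v * (2 * sqrt (S v)))" if "v \<in> V" for v
    using that
  proof (induction v rule: measure_induct_rule[of rank])
    case (less v)
    note v = less.prems
    define b where "b = 1 / (c v * f v * sqrt (S v))"
    have ab: "sqrt (D v) = sqrt (a v * b)" and b: "0 \<le> b"
      using f[OF v] c[OF v] S[OF v] by (auto simp: a_def b_def)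
    have "P v w * \<bar>x w\<bar> \<le> P v w * sqrt (A w * (2 * sqrt (S w)))" if "w \<in> V" for w
      using less.IH[of w] v P_nonneg[of v w] P_rank[of v w] that
      by (cases "P v w = 0") (auto intro: mult_left_mono)
    then have "(\<Sum>w\<in>V. P v w * \<bar>x w\<bar>) \<le> (\<Sum>w\<in>V. P v w * sqrt (A w * (2 * sqrt (S w))))"
      by (rule sum_mono)
    also have "\<dots> \<le> sqrt ((\<Sum>w\<in>V. P v w * A w) * (\<Sum>w\<in>V. P v w * (2 * sqrt (S w))))"
      using P_nonneg v A S by (intro sum_mult_sqrt_le) (auto intro: less_imp_le)
    finally have "\<bar>x v\<bar> \<le> sqrt (a v * b) +
        sqrt ((\<Sum>w\<in>V. P v w * A w) * (\<Sum>w\<in>V. P v w * (2 * sqrt (S w))))"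
      using x[OF v] ab by simp
    also have "\<dots> \<le> sqrt ((a v + (\<Sum>w\<in>V. P v w * A w)) * (b + (\<Sum>w\<in>V. P v w * (2 * sqrt (S w)))))"
      using a[OF v] b P_nonneg v A S
      by (intro sqrt_mult_add_le sum_nonneg mult_nonneg_nonneg) (auto intro: less_imp_le)
    also have "a v + (\<Sum>w\<in>V. P v w * A w) = A v"
      using A_step[OF v] by simp
    also have "sqrt (A v * (b + (\<Sum>w\<in>V. P v w * (2 * sqrt (S w))))) \<le> sqrt (A v * (2 * sqrt (S v)))"
    proof -
      have "1 / (f v * c v) / sqrt (S v) + (\<Sum>w\<in>V. P v w * (2 * sqrt (S w))) \<le> 2 * sqrt (S v)"
        using P_nonneg P_substochastic v S by (intro sqrt_increment S_step) (auto intro: less_imp_le)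
      then have "b + (\<Sum>w\<in>V. P v w * (2 * sqrt (S w))) \<le> 2 * sqrt (S v)"
        by (simp add: b_def mult_ac)
      then show ?thesis
        using A[OF v] by (intro real_sqrt_le_mono mult_left_mono)
    qed
    finally show ?case .
  qed
  have x2_le: "(x v)\<^sup>2 \<le> A v * (2 * sqrt (S v))" if "v \<in> V" for v
    using x_le[OF that] A[OF that] S[OF that]
    by (metis real_sqrt_le_iff real_sqrt_abs)

  define m where "m v = f v * M v" for v
  have m: "0 < m v" if "v \<in> V" for v
    using f[OF that] M[OF that] by (simp add: m_def)
  have Sm: "sqrt (S v) * sqrt (m v) \<le> sqrt K" if "v \<in> V" for v
    using K[OF that] by (simp add: m_def flip: real_sqrt_mult)

  text \<open>Dividing by \<open>1 / f\<close> turns the transpose of \<open>P\<close> into a substochastic kernel, for which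
    \<open>m\<close> plays the role that \<open>S\<close> plays for \<open>P\<close>.\<close>
  have dual: "c v * sqrt (S v) + (\<Sum>z\<in>V. P z v * (2 * sqrt K * sqrt (m z) / f z))
      \<le> 2 * sqrt K * sqrt (m v) / f v" if v: "v \<in> V" for v
  proof -
    define q where "q z = f v * P z v / f z" for z
    have "(\<Sum>z\<in>V. q z) = f v * (\<Sum>z\<in>V. P z v / f z)"
      by (simp add: q_def sum_distrib_left)
    also have "\<dots> \<le> f v * (1 / f v)"
      using f[OF v] f_super[OF v] by (intro mult_left_mono) auto
    finally have q1: "(\<Sum>z\<in>V. q z) \<le> 1" using f[OF v] by simp
    have q0: "0 \<le> q z" if "z \<in> V" for z
      using P_nonneg[OF that v] f[OF v] f[OF that] by (simp add: q_def)
    have "m v = f v * c v + f v * (\<Sum>z\<in>V. P z v * M z)"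
      using M_step[OF v] by (simp add: m_def algebra_simps)
    also have "f v * (\<Sum>z\<in>V. P z v * M z) = (\<Sum>z\<in>V. q z * m z)"
      using f[THEN less_imp_neq] unfolding q_def m_def sum_distrib_left
      by (intro sum.cong refl) (simp add: field_simps)
    finally have m_step: "m v = f v * c v + (\<Sum>z\<in>V. q z * m z)" .
    have *: "f v * c v / sqrt (m v) + (\<Sum>z\<in>V. q z * (2 * sqrt (m z))) \<le> 2 * sqrt (m v)"
      using q0 q1 m by (intro sqrt_increment m_step m v) (auto intro: less_imp_le)
    \<comment> \<open>The bound \<open>S m \<le> K\<close> replaces \<open>sqrt S\<close> by
      \<open>sqrt K / sqrt m\<close>, which produces the source term controlled by
      \<open>*\<close>.\<close>
    have "f v * (c v * sqrt (S v)) \<le> f v * (c v * (sqrt K / sqrt (m v)))"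
      using f[OF v] c[OF v] m[OF v] Sm[OF v] by (intro mult_left_mono) (auto simp: field_simps)
    also have "\<dots> = sqrt K * (f v * c v / sqrt (m v))"
      by simp
    finally have "f v * (c v * sqrt (S v)) + sqrt K * (\<Sum>z\<in>V. q z * (2 * sqrt (m z)))
        \<le> sqrt K * (f v * c v / sqrt (m v) + (\<Sum>z\<in>V. q z * (2 * sqrt (m z))))"
      by (simp add: distrib_left)
    also have "\<dots> \<le> sqrt K * (2 * sqrt (m v))"
      using * K0[OF v] by (intro mult_left_mono) auto
    also have "sqrt K * (\<Sum>z\<in>V. q z * (2 * sqrt (m z))) =
        f v * (\<Sum>z\<in>V. P z v * (2 * sqrt K * sqrt (m z) / f z))"
      by (simp add: q_def sum_distrib_left mult_ac)
    finally show ?thesis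
      using f[OF v] by (simp add: field_simps)
  qed

  have "(\<Sum>v\<in>V. c v * (x v)\<^sup>2) \<le> (\<Sum>v\<in>V. c v * (A v * (2 * sqrt (S v))))"
    using x2_le c by (intro sum_mono mult_left_mono) (auto intro: less_imp_le)
  also have "\<dots> = 2 * (\<Sum>v\<in>V. \<Sum>w\<in>V. (c v * sqrt (S v)) * G v w * a w)"
    by (simp add: A_def sum_distrib_left mult_ac)
  also have "\<dots> = 2 * (\<Sum>w\<in>V. a w * (\<Sum>v\<in>V. c v * sqrt (S v) * G v w))"
    by (subst sum.swap) (simp add: sum_distrib_left mult_ac)
  also have "\<dots> \<le> 2 * (\<Sum>w\<in>V. a w * (2 * sqrt K * sqrt (m w) / f w))"
    using a dual by (intro mult_left_mono sum_mono copotential_le) auto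
  also have "\<dots> \<le> 2 * (\<Sum>w\<in>V. 2 * K * (c w * D w))"
  proof (intro mult_left_mono sum_mono)
    fix w assume w: "w \<in> V"
    \<comment> \<open>The factor \<open>f\<close> in \<open>a\<close> cancels. What remains is
      \<open>sqrt S * sqrt m\<close>, so \<open>S m \<le> K\<close> applies a second time and the
      two factors \<open>sqrt K\<close> combine to \<open>K\<close>.\<close>
    have "a w * (2 * sqrt K * sqrt (m w) / f w) = 2 * (c w * D w) * sqrt K * (sqrt (S w) * sqrt (m w))"
      using f[OF w] by (simp add: a_def)
    also have "\<dots> \<le> 2 * (c w * D w) * sqrt K * sqrt K"
      using Sm[OF w] K0[OF w] c[OF w] D[OF w] by (intro mult_left_mono) auto
    also have "\<dots> = 2 * K * (c w * D w)"
      using K0[OF w] by simp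
    finally show "a w * (2 * sqrt K * sqrt (m w) / f w) \<le> 2 * K * (c w * D w)" .
  qed auto
  finally show ?thesis
    by (simp add: sum_distrib_left mult_ac)
qed

end

section \<open>Spanning trees as choices of incoming edges\<close>

definition level :: "node \<Rightarrow> nat" where
  "level v = fst v + snd v"

definition inner_nodes :: "nat \<Rightarrow> node set" where
  "inner_nodes N = {v \<in> nodes N. 2 \<le> level v}"

lemma inner_nodes_eq: "inner_nodes N = {(r, s). 2 \<le> r + s \<and> r + s \<le> N}"
  by (auto simp: inner_nodes_def nodes_def level_def)

lemma finite_nodes [simp]: "finite (nodes N)"
  by (rule finite_subset[of _ "{..N} \<times> {..N}"]) (auto simp: nodes_def)

lemma finite_inner_nodes [simp]: "finite (inner_nodes N)"
  by (simp add: inner_nodes_def)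

lemma finite_edges [simp]: "finite (edges N)"
  by (rule finite_subset[of _ "nodes N \<times> nodes N"], force simp: edges_def nodes_def) simp

lemma edgeD:
  assumes "a \<in> edges N"
  shows "fst a \<in> nodes N" "snd a \<in> inner_nodes N" "level (snd a) = Suc (level (fst a))"
  using assms by (auto simp: edges_def nodes_def inner_nodes_def level_def)

lemma node_cases:
  assumes "v \<in> nodes N"
  obtains "level v = 1" | "v \<in> inner_nodes N"
  using assms by (force simp: nodes_def inner_nodes_def level_def)

lemma fuse_root: "level v = 1 \<Longrightarrow> fuse v = root_node"
  by (cases v) (auto simp: fuse_def level_def add_is_1)

lemma fuse_inner: "v \<in> inner_nodes N \<Longrightarrow> fuse v = v"
  by (auto simp: fuse_def inner_nodes_def level_def)

lemma inner_neq_root: "v \<in> inner_nodes N \<Longrightarrow> v \<noteq> root_node"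
  by (auto simp: inner_nodes_def level_def root_node_def)

text \<open>A tree is described by incoming edges, so walks from the root have to be taken apart at
  their last arc.\<close>

lemma (in wf_digraph) awalk_snoc_iff:
  "awalk u (p @ [a]) w \<longleftrightarrow> a \<in> arcs G \<and> head G a = w \<and> awalk u p (tail G a)"
  using awlast_if_cas[of u p "tail G a"]
  by (auto simp: awalk_simps awalk_def)

text \<open>Indexing by unfused nodes gives both nodes of level 1 the same walks and allows
  induction on \<open>level\<close> in the original graph.\<close>

definition root_walk :: "nat \<Rightarrow> edge set \<Rightarrow> edge list \<Rightarrow> node \<Rightarrow> bool" where
  "root_walk N T p v = pre_digraph.awalk (fused_graph N T) root_node p (fuse v)"

lemma wf_fused_graph:
  assumes "T \<subseteq> edges N"
  shows "wf_digraph (fused_graph N T)"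
proof
  fix a assume "a \<in> arcs (fused_graph N T)"
  then have "a \<in> edges N" using assms by (auto simp: fused_graph_def)
  then have "fst a \<in> nodes N" "snd a \<in> nodes N"
    using edgeD(1,2)[of a N] by (simp_all add: inner_nodes_def)
  then show "tail (fused_graph N T) a \<in> verts (fused_graph N T)"
    "head (fused_graph N T) a \<in> verts (fused_graph N T)"
    by (simp_all add: fused_graph_def)
qed

text \<open>Every arc ends in an inner node, so none enters the root.\<close>

lemma root_walk_level1:
  assumes T: "T \<subseteq> edges N" and v: "v \<in> nodes N" "level v = 1"
  shows "root_walk N T p v \<longleftrightarrow> p = []"
proof -
  interpret wf_digraph "fused_graph N T" using T by (rule wf_fused_graph)
  have "root_node \<in> verts (fused_graph N T)"
    using v fuse_root[of v] by (force simp: fused_graph_def)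
  moreover have "fuse (snd a) \<noteq> root_node" if "a \<in> T" for a
    using that T by (metis subsetD edgeD(2) fuse_inner inner_neq_root)
  ultimately show ?thesis
    using v unfolding root_walk_def
    by (cases p rule: rev_cases)
      (simp_all add: fuse_root awalk_snoc_iff awalk_Nil_iff del: awalk_append_iff,
       auto simp: fused_graph_def)
qed

lemma root_walk_inner:
  assumes T: "T \<subseteq> edges N" and v: "v \<in> inner_nodes N"
  shows "root_walk N T p v \<longleftrightarrow> (\<exists>q a. p = q @ [a] \<and> a \<in> T \<and> snd a = v \<and> root_walk N T q (fst a))"
proof -
  interpret wf_digraph "fused_graph N T" using T by (rule wf_fused_graph)
  have "fuse (snd a) = snd a" if "a \<in> T" for a
    using that T by (metis subsetD edgeD(2) fuse_inner)
  then show ?thesis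
    using inner_neq_root[OF v] fuse_inner[OF v] unfolding root_walk_def
    by (cases p rule: rev_cases)
      (simp_all add: awalk_snoc_iff awalk_Nil_iff del: awalk_append_iff,
       auto simp: fused_graph_def)
qed

text \<open>Edges raise the level by one, so cycles cannot occur. Two edges into the same node would
  extend to two different walks; conversely, unique incoming edges give unique walks by induction on
  the level.\<close>

theorem spanning_trees_iff:
  "T \<in> spanning_trees N \<longleftrightarrow> T \<subseteq> edges N \<and> (\<forall>v \<in> inner_nodes N. \<exists>!a. a \<in> T \<and> snd a = v)"
proof (cases "T \<subseteq> edges N")
  case True
  have "T \<in> spanning_trees N \<longleftrightarrow> (\<forall>v \<in> nodes N. \<exists>!p. root_walk N T p v)"
    using True by (auto simp: spanning_trees_def root_walk_def fused_graph_def)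
  also have "\<dots> \<longleftrightarrow> (\<forall>v \<in> inner_nodes N. \<exists>!a. a \<in> T \<and> snd a = v)" (is "?L \<longleftrightarrow> ?R")
  proof
    assume L: ?L
    show ?R
    proof
      fix v assume v: "v \<in> inner_nodes N"
      then obtain p where "root_walk N T p v"
        using L by (auto simp: inner_nodes_def)
      then obtain a where a: "a \<in> T" "snd a = v"
        using root_walk_inner[OF True v] by auto
      have "b = a" if b: "b \<in> T" "snd b = v" for b
      proof -
        obtain p q where "root_walk N T p (fst a)" "root_walk N T q (fst b)"
          using L a b True by (meson edgeD(1) subsetD)
        then have "root_walk N T (p @ [a]) v" "root_walk N T (q @ [b]) v"
          using a b by (simp_all add: root_walk_inner[OF True v] del: split_paired_Ex)
        then have "p @ [a] = q @ [b]"
          using L v unfolding inner_nodes_def by blast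
        then show ?thesis by simp
      qed
      with a show "\<exists>!a. a \<in> T \<and> snd a = v" by blast
    qed
  next
    assume R: ?R
    have "\<exists>!p. root_walk N T p v" if "v \<in> nodes N" for v
      using that
    proof (induction v rule: measure_induct_rule[of level])
      case (less v)
      from less.prems show ?case
      proof (cases rule: node_cases)
        case 1
        then show ?thesis using root_walk_level1[OF True less.prems] by simp
      next
        case 2
        then obtain a where a: "a \<in> T" "snd a = v" and uniq: "\<And>b. b \<in> T \<Longrightarrow> snd b = v \<Longrightarrow> b = a"
          using R by blast
        have "\<exists>!q. root_walk N T q (fst a)"
          using edgeD[of a N] a True by (intro less.IH) auto
        then obtain q where q: "\<And>q'. root_walk N T q' (fst a) \<longleftrightarrow> q' = q"
          by metis
        have "root_walk N T p v \<longleftrightarrow> p = q @ [a]" for p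
          unfolding root_walk_inner[OF True 2] using a uniq q by blast
        then show ?thesis by simp
      qed
    qed
    then show ?L by blast
  qed
  finally show ?thesis using True by simp
qed (auto simp: spanning_trees_def)

section \<open>Paths and subtrees of a fixed spanning tree\<close>

context
  fixes N :: nat and T :: "edge set"
  assumes T: "T \<in> spanning_trees N"
begin

lemma tree_subset: "T \<subseteq> edges N"
  using T by (simp add: spanning_trees_iff)

lemma tree_edgeD:
  assumes "a \<in> T"
  shows "fst a \<in> nodes N" "snd a \<in> inner_nodes N" "level (snd a) = Suc (level (fst a))"
  using assms tree_subset edgeD by blast+

lemma tree_in_edge: "v \<in> inner_nodes N \<Longrightarrow> \<exists>!a. a \<in> T \<and> snd a = v"
  using T by (simp add: spanning_trees_iff)

lemma tree_in_edge_unique: "a \<in> T \<Longrightarrow> b \<in> T \<Longrightarrow> snd a = snd b \<Longrightarrow> a = b"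
  using tree_in_edge tree_edgeD(2) by metis

text \<open>Each inner node is the head of a tree edge whose tail has smaller level.\<close>

lemma tree_induct [consumes 1, case_names root step]:
  assumes "v \<in> nodes N"
    and root: "\<And>v. v \<in> nodes N \<Longrightarrow> level v = 1 \<Longrightarrow> Q v"
    and step: "\<And>a. a \<in> T \<Longrightarrow> Q (fst a) \<Longrightarrow> Q (snd a)"
  shows "Q v"
  using assms(1)
proof (induction v rule: measure_induct_rule[of level])
  case (less v)
  from less.prems show ?case
  proof (cases rule: node_cases)
    case 2
    then obtain a where "a \<in> T" "snd a = v"
      using tree_in_edge by blast
    then show ?thesis
      using less.IH[of "fst a"] step[of a] tree_edgeD[of a] by auto
  qed (use root less.prems in auto)
qed

lemma root_walk_tree_path:
  assumes "v \<in> nodes N"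
  shows "root_walk N T p v \<longleftrightarrow> p = tree_path N T v"
proof -
  have "\<exists>!p. root_walk N T p v"
    using T assms unfolding spanning_trees_def root_walk_def fused_graph_def by auto
  moreover have "tree_path N T v = (THE p. root_walk N T p v)"
    by (simp add: tree_path_def root_walk_def)
  ultimately show ?thesis by (metis the_equality)
qed

lemma tree_path_root: "v \<in> nodes N \<Longrightarrow> level v = 1 \<Longrightarrow> tree_path N T v = []"
  using root_walk_tree_path root_walk_level1[OF tree_subset] by metis

lemma tree_path_step:
  assumes "a \<in> T"
  shows "tree_path N T (snd a) = tree_path N T (fst a) @ [a]"
proof -
  have "root_walk N T (tree_path N T (fst a) @ [a]) (snd a)"
    using assms tree_edgeD[OF assms] by (simp add: root_walk_inner[OF tree_subset] root_walk_tree_path)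
  then show ?thesis
    using tree_edgeD[OF assms] root_walk_tree_path by (simp add: inner_nodes_def)
qed

lemma tree_path_level:
  assumes "v \<in> nodes N" "a \<in> set (tree_path N T v)"
  shows "level (snd a) \<le> level v"
  using assms
proof (induction v rule: tree_induct)
  case (step b)
  then show ?case using tree_edgeD(3)[OF step(1)] by (auto simp: tree_path_step)
qed (simp add: tree_path_root)

lemma path_sum_root: "v \<in> nodes N \<Longrightarrow> level v = 1 \<Longrightarrow> path_sum N v g T = 0"
  by (simp add: path_sum_def tree_path_root)

lemma path_sum_step: "a \<in> T \<Longrightarrow> path_sum N (snd a) g T = g (snd a) + path_sum N (fst a) g T"
  by (simp add: path_sum_def tree_path_step)

text \<open>Levels increase along a path, so it meets a node at most once. The expectation of this
  indicator will be the Green function.\<close>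

lemma path_sum_indicator:
  assumes "w \<in> nodes N"
  shows "path_sum N w (\<lambda>x. of_bool (x = v)) T = of_bool (v \<in> snd ` set (tree_path N T w))"
  using assms
proof (induction w rule: tree_induct)
  case (step a)
  have "snd a \<notin> snd ` set (tree_path N T (fst a))"
    using tree_path_level[of "fst a"] tree_edgeD[OF step(1)] by force
  then show ?case using step by (auto simp: path_sum_step tree_path_step)
qed (simp add: path_sum_root tree_path_root)

text \<open>A walk from \<open>v\<close> to \<open>w\<close>, appended to the path to
  \<open>v\<close>, is the unique root walk to \<open>w\<close>; conversely, the path to
  \<open>w\<close> can be cut at \<open>v\<close>. The node \<open>v\<close> has to be inner because
  the root is not the endpoint of an edge.\<close>

lemma subtree_iff:
  assumes v: "v \<in> inner_nodes N" and w: "w \<in> nodes N"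
  shows "w \<in> subtree N T v \<longleftrightarrow> v \<in> snd ` set (tree_path N T w)"
proof -
  interpret wf_digraph "fused_graph N T" using tree_subset by (rule wf_fused_graph)
  have w_path: "awalk root_node (tree_path N T w) (fuse w)"
    using root_walk_tree_path[OF w] by (simp add: root_walk_def)
  have "fuse v \<rightarrow>\<^sup>*\<^bsub>fused_graph N T\<^esub> fuse w \<longleftrightarrow> v \<in> snd ` set (tree_path N T w)"
  proof
    assume "fuse v \<rightarrow>\<^sup>*\<^bsub>fused_graph N T\<^esub> fuse w"
    then obtain p where p: "awalk (fuse v) p (fuse w)"
      by (auto simp: reachable_awalk)
    have "v \<in> nodes N" using v by (simp add: inner_nodes_def)
    then have "awalk root_node (tree_path N T v) (fuse v)"
      using root_walk_tree_path by (simp add: root_walk_def)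
    then have "awalk root_node (tree_path N T v @ p) (fuse w)"
      using p by (rule awalk_appendI)
    then have "tree_path N T w = tree_path N T v @ p"
      using root_walk_tree_path[OF w] unfolding root_walk_def by metis
    moreover obtain a where a: "a \<in> T" "snd a = v"
      using tree_in_edge[OF v] by blast
    then have "tree_path N T v = tree_path N T (fst a) @ [a]"
      using tree_path_step by blast
    ultimately show "v \<in> snd ` set (tree_path N T w)"
      using a by auto
  next
    assume "v \<in> snd ` set (tree_path N T w)"
    then obtain a xs ys where a: "snd a = v" "tree_path N T w = xs @ a # ys"
      by (auto dest!: split_list)
    then have "awalk (fuse v) ys (fuse w)"
      using w_path by (simp add: awalk_Cons_iff) (simp add: fused_graph_def)
    then show "fuse v \<rightarrow>\<^sup>*\<^bsub>fused_graph N T\<^esub> fuse w"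
      by (auto simp: reachable_awalk)
  qed
  then show ?thesis using w by (simp add: subtree_def)
qed

text \<open>By \<open>subtree_iff\<close>, descendants of \<open>v\<close> are the nodes whose path
  meets \<open>v\<close>. Nodes of level 1 drop out because their path is empty.\<close>

lemma subtree_sum_eq:
  assumes v: "v \<in> inner_nodes N"
  shows "subtree_sum N v c T = (\<Sum>w\<in>inner_nodes N. c w * path_sum N w (\<lambda>x. of_bool (x = v)) T)"
proof -
  have "subtree_sum N v c T = (\<Sum>w\<in>nodes N. if w \<in> subtree N T v then c w else 0)"
    unfolding subtree_sum_def by (subst sum.inter_filter[symmetric]) (auto simp: subtree_def)
  also have "\<dots> = (\<Sum>w\<in>nodes N. c w * path_sum N w (\<lambda>x. of_bool (x = v)) T)"
    using v by (intro sum.cong) (auto simp: path_sum_indicator subtree_iff)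
  also have "\<dots> = (\<Sum>w\<in>inner_nodes N. c w * path_sum N w (\<lambda>x. of_bool (x = v)) T)"
    using node_cases path_sum_root
    by (intro sum.mono_neutral_right) (auto simp: inner_nodes_def, metis)
  finally show ?thesis .
qed

section \<open>Exchanging an incoming edge\<close>

lemma exchange_in_spanning_trees:
  assumes a: "a \<in> T" and b: "b \<in> edges N" "snd b = snd a"
  shows "insert b (T - {a}) \<in> spanning_trees N"
  unfolding spanning_trees_iff
proof (intro conjI ballI)
  fix v assume v: "v \<in> inner_nodes N"
  show "\<exists>!x. x \<in> insert b (T - {a}) \<and> snd x = v"
    using tree_in_edge[OF v] a b tree_in_edge_unique by (metis Diff_iff insert_iff singletonD)
qed (use tree_subset b in auto)

end

text \<open>The choice made at \<open>snd a\<close> affects only paths that reach its level. This is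
  the source of independence.\<close>

lemma tree_path_exchange:
  assumes T: "T \<in> spanning_trees N" and a: "a \<in> T" and b: "b \<in> edges N" "snd b = snd a"
    and v: "v \<in> nodes N" "level v < level (snd a)"
  shows "tree_path N (insert b (T - {a})) v = tree_path N T v"
  using v
proof (induction v rule: tree_induct[OF T, consumes 1, case_names root step])
  case (root v)
  then show ?case
    using T exchange_in_spanning_trees[OF T a b] by (simp add: tree_path_root)
next
  case (step x)
  \<comment> \<open>The head of \<open>x\<close> lies on a lower level than that of
    \<open>a\<close>, so \<open>x\<close> differs from \<open>a\<close> and survives the
    exchange.\<close>
  then have "x \<in> insert b (T - {a})" by auto
  then show ?case
    using step T exchange_in_spanning_trees[OF T a b] tree_edgeD[OF T step(1)]
    by (simp add: tree_path_step)
qed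

lemma finite_spanning_trees [simp]: "finite (spanning_trees N)"
  by (rule finite_subset[of _ "Pow (edges N)"]) (auto simp: spanning_trees_def)

lemma spanning_trees_nonempty: "spanning_trees N \<noteq> {}"
proof -
  \<comment> \<open>The comb: every node is entered horizontally, except on the axis
    \<open>r = 0\<close>, where only the vertical edge exists.\<close>
  define T where "T = {a \<in> edges N. fst (fst a) < fst (snd a) \<or> fst (snd a) = 0}"
  have "\<exists>!a. a \<in> T \<and> snd a = v" if "v \<in> inner_nodes N" for v
  proof -
    obtain r s where v: "v = (r, s)" by fastforce
    define a where "a = (if r = 0 then ((r, s - 1), (r, s)) else ((r - 1, s), (r, s)))"
    show ?thesis
      by (rule ex1I[of _ a])
       (use that in \<open>auto simp: v a_def T_def edges_def inner_nodes_eq nodes_def\<close>)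
  qed
  then have "T \<in> spanning_trees N"
    by (auto simp: spanning_trees_iff T_def)
  then show ?thesis by blast
qed

section \<open>The random spanning tree\<close>

definition in_edges :: "nat \<Rightarrow> node \<Rightarrow> edge set" where
  "in_edges N v = {a \<in> edges N. snd a = v}"

lemma finite_in_edges [simp]: "finite (in_edges N v)"
  by (simp add: in_edges_def)

text \<open>Exchanging the edge \<open>a\<close> for \<open>b\<close> scales the weight of a tree by \<open>e b / e a\<close>. So the
  choices of the incoming edges at different nodes are independent.\<close>

lemma sum_exchange:
  assumes ab: "a \<in> in_edges N v" "b \<in> in_edges N v"
    and X: "\<And>T. T \<in> spanning_trees N \<Longrightarrow> a \<in> T \<Longrightarrow> X (insert b (T - {a})) = X T"
  shows "e a * (\<Sum>T | T \<in> spanning_trees N \<and> b \<in> T. tree_weight e T * X T) =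
    e b * (\<Sum>T | T \<in> spanning_trees N \<and> a \<in> T. tree_weight e T * X T)"
proof (cases "a = b")
  case False
  have ab': "a \<in> edges N" "b \<in> edges N" "snd b = snd a" using ab by (auto simp: in_edges_def)
  have notin: "y \<notin> T" if "T \<in> spanning_trees N" "x \<in> T" "snd x = snd y" "x \<noteq> y" for T x y
    using that tree_in_edge_unique by blast
  have weight: "e b * tree_weight e T = e a * tree_weight e (insert b (T - {a}))"
    if T: "T \<in> spanning_trees N" "a \<in> T" for T
  proof -
    have fin: "finite T" using tree_subset[OF T(1)] finite_edges by (rule finite_subset)
    have "b \<notin> T" using notin[OF T] ab' False by auto
    then show ?thesis
      using fin T by (simp add: tree_weight_def prod.remove[of T a])
  qed
  show ?thesis
    unfolding sum_distrib_left
  proof (rule sum.reindex_bij_witness[of _ "\<lambda>T. insert b (T - {a})" "\<lambda>T. insert a (T - {b})"], goal_cases)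
    case (1 T)
    then show ?case using notin[of T b a] ab' False by auto
  next
    case (2 T)
    then show ?case using exchange_in_spanning_trees[of T N b a] ab' by auto
  next
    case (3 T)
    then show ?case using notin[of T a b] ab' False by auto
  next
    case (4 T)
    then show ?case using exchange_in_spanning_trees[of T N a b] ab' by auto
  next
    case (5 T)
    then have T: "T \<in> spanning_trees N" "b \<in> T" by auto
    define T' where "T' = insert a (T - {b})"
    have T': "T' \<in> spanning_trees N" "a \<in> T'" "insert b (T' - {a}) = T"
      using exchange_in_spanning_trees[of T N b a] T ab' notin[of T b a] False by (auto simp: T'_def)
    show ?case
      using weight[OF T'(1,2)] X[OF T'(1,2)] T'(3) unfolding T'_def[symmetric] by simp
  qed
qed simp

definition in_prob :: "nat \<Rightarrow> (edge \<Rightarrow> real) \<Rightarrow> edge \<Rightarrow> real" where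
  "in_prob N e a = e a / (\<Sum>b \<in> in_edges N (snd a). e b)"

definition total_weight :: "nat \<Rightarrow> (edge \<Rightarrow> real) \<Rightarrow> real" where
  "total_weight N e = (\<Sum>T \<in> spanning_trees N. tree_weight e T)"

locale positive_weights =
  fixes N :: nat and e :: "edge \<Rightarrow> real"
  assumes e_pos: "\<And>a. a \<in> edges N \<Longrightarrow> e a > 0"
begin

lemma tree_weight_pos: "T \<in> spanning_trees N \<Longrightarrow> tree_weight e T > 0"
  unfolding tree_weight_def using e_pos tree_subset by (blast intro: prod_pos)

lemma total_weight_pos: "total_weight N e > 0"
  using spanning_trees_nonempty tree_weight_pos by (auto simp: total_weight_def intro!: sum_pos)

lemma in_weight_pos: "v \<in> inner_nodes N \<Longrightarrow> (\<Sum>b \<in> in_edges N v. e b) > 0"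
proof (rule sum_pos)
  assume v: "v \<in> inner_nodes N"
  obtain T where T: "T \<in> spanning_trees N"
    using spanning_trees_nonempty by blast
  then show "in_edges N v \<noteq> {}"
    using tree_in_edge[OF T v] tree_subset[OF T] unfolding in_edges_def by blast
qed (use e_pos in \<open>auto simp: in_edges_def\<close>)

lemma expectation_tree_measure:
  "integral\<^sup>L (tree_measure N e) X =
    (\<Sum>T \<in> spanning_trees N. tree_weight e T * X T) / total_weight N e"
  using tree_weight_pos total_weight_pos unfolding tree_measure_def total_weight_def
  by (subst lebesgue_integral_point_measure_finite)
    (auto simp: sum_divide_distrib less_imp_le intro!: divide_nonneg_pos)

text \<open>The trees are partitioned according to their unique edge into \<open>v\<close>.\<close>

lemma sum_split_in_edges:
  assumes v: "v \<in> inner_nodes N"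
  shows "(\<Sum>T \<in> spanning_trees N. Y T) =
    (\<Sum>a \<in> in_edges N v. \<Sum>T | T \<in> spanning_trees N \<and> a \<in> T. Y T)"
proof -
  have "(\<Sum>T \<in> spanning_trees N. Y T) =
      (\<Sum>T \<in> spanning_trees N. \<Sum>a \<in> in_edges N v. if a \<in> T then Y T else 0)"
  proof (intro sum.cong refl)
    fix T assume T: "T \<in> spanning_trees N"
    then obtain a where a: "a \<in> T" "snd a = v" and uniq: "\<And>b. b \<in> T \<Longrightarrow> snd b = v \<Longrightarrow> b = a"
      using tree_in_edge[OF T v] by blast
    have "(\<Sum>b \<in> in_edges N v. if b \<in> T then Y T else 0) = (\<Sum>b \<in> in_edges N v. if b = a then Y T else 0)"
    proof (intro sum.cong refl if_cong)
      fix b assume "b \<in> in_edges N v"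
      then have "snd b = v" by (simp add: in_edges_def)
      then show "b \<in> T \<longleftrightarrow> b = a" using a(1) uniq by blast
    qed
    also have "\<dots> = Y T"
      using subsetD[OF tree_subset[OF T] a(1)] a(2) by (simp add: in_edges_def)
    finally show "Y T = (\<Sum>b \<in> in_edges N v. if b \<in> T then Y T else 0)" ..
  qed
  also have "\<dots> = (\<Sum>a \<in> in_edges N v. \<Sum>T \<in> spanning_trees N. if a \<in> T then Y T else 0)"
    by (rule sum.swap)
  also have "\<dots> = (\<Sum>a \<in> in_edges N v. \<Sum>T | T \<in> spanning_trees N \<and> a \<in> T. Y T)"
    by (rule sum.cong[OF refl], rule sum.inter_filter[symmetric]) simp
  finally show ?thesis .
qed

text \<open>For \<open>X\<close> independent of the choice at \<open>snd a\<close>,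
  \<open>sum_exchange\<close> makes the contributions of the possible incoming edges proportional to
  their weights. Summing over these edges identifies the factor as \<open>in_prob\<close>.\<close>

lemma sum_in_edge:
  assumes a: "a \<in> edges N"
    and X: "\<And>T b. T \<in> spanning_trees N \<Longrightarrow> a \<in> T \<Longrightarrow> b \<in> edges N \<Longrightarrow> snd b = snd a \<Longrightarrow>
      X (insert b (T - {a})) = X T"
  shows "(\<Sum>T | T \<in> spanning_trees N \<and> a \<in> T. tree_weight e T * X T) =
    in_prob N e a * (\<Sum>T \<in> spanning_trees N. tree_weight e T * X T)"
proof -
  have v: "snd a \<in> inner_nodes N" using a by (rule edgeD)
  let ?W = "\<lambda>a. \<Sum>T | T \<in> spanning_trees N \<and> a \<in> T. tree_weight e T * X T"
  have "e a * (\<Sum>T \<in> spanning_trees N. tree_weight e T * X T) = (\<Sum>b \<in> in_edges N (snd a). e a * ?W b)"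
    using sum_split_in_edges[OF v] by (simp add: sum_distrib_left)
  also have "\<dots> = (\<Sum>b \<in> in_edges N (snd a). e b * ?W a)"
    using a X by (intro sum.cong refl sum_exchange) (auto simp: in_edges_def)
  also have "\<dots> = (\<Sum>b \<in> in_edges N (snd a). e b) * ?W a"
    by (simp add: sum_distrib_right)
  finally show ?thesis
    using in_weight_pos[OF v] by (simp add: in_prob_def field_simps)
qed

lemma sum_in_prob:
  assumes "v \<in> inner_nodes N"
  shows "(\<Sum>a \<in> in_edges N v. in_prob N e a) = 1"
proof -
  have "(\<Sum>a \<in> in_edges N v. in_prob N e a) = (\<Sum>a \<in> in_edges N v. e a / (\<Sum>b \<in> in_edges N v. e b))"
    by (intro sum.cong) (auto simp: in_prob_def in_edges_def)
  then show ?thesis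
    using in_weight_pos[OF assms] by (simp flip: sum_divide_distrib)
qed

section \<open>Expectations and the parent chain\<close>

abbreviation mean_path_sum :: "node \<Rightarrow> (node \<Rightarrow> real) \<Rightarrow> real" where
  "mean_path_sum v g \<equiv> integral\<^sup>L (tree_measure N e) (path_sum N v g)"

lemma mean_path_sum_root:
  assumes "v \<in> nodes N" "level v = 1"
  shows "mean_path_sum v g = 0"
  unfolding expectation_tree_measure using assms by (simp add: path_sum_root)

text \<open>Condition on the edge \<open>a\<close> into \<open>v\<close>: the rest of the path, up
  to \<open>fst a\<close>, stays below the level of \<open>v\<close> and is therefore independent of
  that choice.\<close>

lemma mean_path_sum_step:
  assumes v: "v \<in> inner_nodes N"
  shows "mean_path_sum v g = g v + (\<Sum>a \<in> in_edges N v. in_prob N e a * mean_path_sum (fst a) g)"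
proof -
  let ?W = "\<lambda>X. \<Sum>T \<in> spanning_trees N. tree_weight e T * X T"
  have "?W (path_sum N v g) =
      (\<Sum>a \<in> in_edges N v. \<Sum>T | T \<in> spanning_trees N \<and> a \<in> T. tree_weight e T * path_sum N v g T)"
    using v by (rule sum_split_in_edges)
  also have "\<dots> = (\<Sum>a \<in> in_edges N v. in_prob N e a * ?W (\<lambda>T. g v + path_sum N (fst a) g T))"
  proof (intro sum.cong refl)
    fix a assume "a \<in> in_edges N v"
    then have a: "a \<in> edges N" "snd a = v" by (auto simp: in_edges_def)
    have "(\<Sum>T | T \<in> spanning_trees N \<and> a \<in> T. tree_weight e T * path_sum N v g T) =
        (\<Sum>T | T \<in> spanning_trees N \<and> a \<in> T. tree_weight e T * (g v + path_sum N (fst a) g T))"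
      using a path_sum_step[of _ N a g] by (intro sum.cong) auto
    also have "\<dots> = in_prob N e a * ?W (\<lambda>T. g v + path_sum N (fst a) g T)"
      using a edgeD[OF a(1)] by (intro sum_in_edge) (auto simp: path_sum_def tree_path_exchange)
    finally show "(\<Sum>T | T \<in> spanning_trees N \<and> a \<in> T. tree_weight e T * path_sum N v g T) =
        in_prob N e a * ?W (\<lambda>T. g v + path_sum N (fst a) g T)" .
  qed
  also have "\<dots> = (\<Sum>a \<in> in_edges N v. in_prob N e a * (g v * total_weight N e + ?W (path_sum N (fst a) g)))"
    by (intro sum.cong) (auto simp: total_weight_def algebra_simps sum.distrib sum_distrib_left)
  also have "\<dots> = g v * total_weight N e * (\<Sum>a \<in> in_edges N v. in_prob N e a) +
      (\<Sum>a \<in> in_edges N v. in_prob N e a * ?W (path_sum N (fst a) g))"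
    by (simp add: algebra_simps sum.distrib sum_distrib_left)
  finally show ?thesis
    using total_weight_pos sum_in_prob[OF v] unfolding expectation_tree_measure
    by (simp add: add_divide_distrib sum_divide_distrib[of _ "in_edges N v"])
qed

text \<open>Linearity of expectation in \<open>subtree_sum_eq\<close>; the result is the copotential
  of \<open>c\<close>, the form required of \<open>M\<close> in
  \<open>hardy_inequality\<close>.\<close>

lemma mean_subtree_sum:
  assumes "v \<in> inner_nodes N"
  shows "integral\<^sup>L (tree_measure N e) (subtree_sum N v c) =
    (\<Sum>w \<in> inner_nodes N. c w * mean_path_sum w (\<lambda>x. of_bool (x = v)))"
proof -
  have "(\<Sum>T \<in> spanning_trees N. tree_weight e T * subtree_sum N v c T) =
      (\<Sum>T \<in> spanning_trees N. \<Sum>w \<in> inner_nodes N.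
        c w * (tree_weight e T * path_sum N w (\<lambda>x. of_bool (x = v)) T))"
    using assms by (intro sum.cong) (auto simp: subtree_sum_eq sum_distrib_left mult_ac)
  also have "\<dots> = (\<Sum>w \<in> inner_nodes N. c w *
      (\<Sum>T \<in> spanning_trees N. tree_weight e T * path_sum N w (\<lambda>x. of_bool (x = v)) T))"
    by (subst sum.swap) (simp add: sum_distrib_left)
  finally show ?thesis
    unfolding expectation_tree_measure by (simp add: sum_divide_distrib[of _ "inner_nodes N"])
qed

definition parent_prob :: "node \<Rightarrow> node \<Rightarrow> real" where
  "parent_prob v w = (if (w, v) \<in> edges N then in_prob N e (w, v) else 0)"

lemma parent_prob_nonneg: "0 \<le> parent_prob v w"
  unfolding parent_prob_def in_prob_def in_edges_def
  by (auto intro!: divide_nonneg_nonneg sum_nonneg e_pos[THEN less_imp_le])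

lemma sum_parent_prob:
  "(\<Sum>a \<in> in_edges N v. in_prob N e a * h (fst a)) = (\<Sum>w \<in> nodes N. parent_prob v w * h w)"
proof -
  have "(\<Sum>w \<in> nodes N. parent_prob v w * h w) =
      (\<Sum>w \<in> {w \<in> nodes N. (w, v) \<in> edges N}. in_prob N e (w, v) * h w)"
    by (subst sum.inter_filter) (auto simp: parent_prob_def intro!: sum.cong)
  also have "\<dots> = (\<Sum>a \<in> in_edges N v. in_prob N e a * h (fst a))"
    by (rule sum.reindex_bij_witness[of _ fst "\<lambda>w. (w, v)"])
      (auto simp: in_edges_def dest: edgeD(1))
  finally show ?thesis ..
qed

text \<open>Functions vanishing at the root do not see the mass that leaves the inner nodes, so the
  chain may be killed there.\<close>

lemma sum_parent_prob_inner:
  assumes "\<And>w. w \<in> nodes N \<Longrightarrow> level w = 1 \<Longrightarrow> h w = 0"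
  shows "(\<Sum>w \<in> nodes N. parent_prob v w * h w) = (\<Sum>w \<in> inner_nodes N. parent_prob v w * h w)"
  using assms node_cases[of _ N]
  by (intro sum.mono_neutral_right) (auto simp: inner_nodes_def, metis)

lemma sum_in_edges_eq:
  assumes "2 \<le> r + s" "r + s \<le> N"
  shows "(\<Sum>a \<in> in_edges N (r, s). k a) =
    (if r = 0 then 0 else k ((r - 1, s), (r, s))) + (if s = 0 then 0 else k ((r, s - 1), (r, s)))"
proof -
  have "in_edges N (r, s) = (if r = 0 then {} else {((r - 1, s), (r, s))}) \<union>
      (if s = 0 then {} else {((r, s - 1), (r, s))})"
    using assms by (auto simp: in_edges_def edges_def nodes_def)
  then show ?thesis by (simp add: add.commute)
qed

text \<open>For \<open>r = 0\<close> the value \<open>h (r - 1, s)\<close> is a default one, but its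
  coefficient is 0; likewise for \<open>s = 0\<close>.\<close>

lemma sum_parent_prob_eq:
  assumes "2 \<le> r + s" "r + s \<le> N"
  shows "(\<Sum>w \<in> nodes N. parent_prob (r, s) w * h w) =
    w_left e r s / (w_left e r s + w_down e r s) * h (r - 1, s) +
    w_down e r s / (w_left e r s + w_down e r s) * h (r, s - 1)"
  using assms unfolding sum_parent_prob[symmetric] sum_in_edges_eq[OF assms]
  by (simp add: in_prob_def sum_in_edges_eq w_left_def w_down_def)

lemma sum_child_eq:
  assumes "2 \<le> r + s" "r + s < N"
  shows "(\<Sum>z \<in> inner_nodes N. parent_prob z (r, s) * h z) =
    w_left e (r + 1) s / (w_left e (r + 1) s + w_down e (r + 1) s) * h (r + 1, s) +
    w_down e r (s + 1) / (w_left e r (s + 1) + w_down e r (s + 1)) * h (r, s + 1)"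
proof -
  have "(\<Sum>z \<in> inner_nodes N. parent_prob z (r, s) * h z) =
      (\<Sum>z \<in> {(r + 1, s), (r, s + 1)}. parent_prob z (r, s) * h z)"
    using assms by (intro sum.mono_neutral_right finite_inner_nodes)
      (auto simp: inner_nodes_def nodes_def level_def parent_prob_def edges_def)
  also have "\<dots> = parent_prob (r + 1, s) (r, s) * h (r + 1, s) + parent_prob (r, s + 1) (r, s) * h (r, s + 1)"
    by simp
  finally show ?thesis
    using assms
    by (simp add: parent_prob_def in_prob_def sum_in_edges_eq w_left_def w_down_def edges_def nodes_def)
qed

lemma sum_child_last:
  assumes "N \<le> level v"
  shows "(\<Sum>z \<in> inner_nodes N. parent_prob z v * h z) = 0"
  using assms by (intro sum.neutral) (auto simp: parent_prob_def edges_def level_def)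

lemma sum_parent_prob_1:
  assumes "v \<in> inner_nodes N"
  shows "(\<Sum>w \<in> nodes N. parent_prob v w) = 1"
  using sum_parent_prob[where h = "\<lambda>_. 1"] sum_in_prob[OF assms] by simp

lemma mean_path_sum_parent:
  assumes "v \<in> inner_nodes N"
  shows "mean_path_sum v g = g v + (\<Sum>w \<in> inner_nodes N. parent_prob v w * mean_path_sum w g)"
  using mean_path_sum_step[OF assms, of g] sum_parent_prob[where h = "\<lambda>w. mean_path_sum w g"]
    sum_parent_prob_inner[of "\<lambda>w. mean_path_sum w g" v] mean_path_sum_root
  by simp

lemma parent_prob_level: "parent_prob v w \<noteq> 0 \<Longrightarrow> level w < level v"
  using edgeD(3)[of "(w, v)" N] by (auto simp: parent_prob_def split: if_splits)

text \<open>The mean of the indicator path sum is the probability that \<open>w\<close> lies on the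
  path to \<open>v\<close>. Rows lose mass exactly at nodes with a parent of level 1.\<close>

lemma green_kernel_tree:
  "green_kernel (inner_nodes N) level parent_prob (\<lambda>v w. mean_path_sum v (\<lambda>x. of_bool (x = w)))"
proof
  fix v assume v: "v \<in> inner_nodes N"
  have "(\<Sum>w \<in> inner_nodes N. parent_prob v w) \<le> (\<Sum>w \<in> nodes N. parent_prob v w)"
    by (rule sum_mono2) (auto simp: inner_nodes_def parent_prob_nonneg)
  then show "(\<Sum>w \<in> inner_nodes N. parent_prob v w) \<le> 1"
    by (simp add: sum_parent_prob_1[OF v])
  show "mean_path_sum v (\<lambda>x. of_bool (x = w)) = of_bool (v = w) +
      (\<Sum>x \<in> inner_nodes N. parent_prob v x * mean_path_sum x (\<lambda>x. of_bool (x = w)))" for w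
    using v by (rule mean_path_sum_parent)
qed (simp_all add: parent_prob_nonneg parent_prob_level)

end

section \<open>The Hardy inequality for the entropy\<close>

lemma Psi_nonneg:
  assumes "0 \<le> x"
  shows "0 \<le> Psi x"
proof (cases "x = 0")
  case False
  \<comment> \<open>Multiplied by \<open>x\<close>, this bound is the claim.\<close>
  have "ln (1 / x) \<le> 1 / x - 1"
    using False assms by (intro ln_le_minus_one) auto
  then have "x * (1 - 1 / x) \<le> x * ln x"
    using False assms by (intro mult_left_mono) (auto simp: ln_div)
  then show ?thesis
    using False by (simp add: Psi_def algebra_simps)
qed (simp add: Psi_def)

theorem theorem2p8:
  fixes N :: nat and e :: "edge \<Rightarrow> real" and f c u :: "node \<Rightarrow> real" and K :: real
  assumes "N \<ge> 2"
    and e_pos: "\<And>a. a \<in> edges N \<Longrightarrow> e a > 0"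
    and f_pos: "\<And>v. v \<in> nodes N \<Longrightarrow> f v > 0"
    and f_rec: "\<And>r s. 1 < r + s \<Longrightarrow> r + s < N \<Longrightarrow>
      1 / f (r, s) =
        w_left e (r + 1) s / (w_left e (r + 1) s + w_down e (r + 1) s) * (1 / f (r + 1, s))
        + w_down e r (s + 1) / (w_left e r (s + 1) + w_down e r (s + 1)) * (1 / f (r, s + 1))"
    and c_pos: "\<And>v. v \<in> nodes N \<Longrightarrow> c v > 0"
    and K_def: "K = (SUP v \<in> nodes N.
      prob_space.expectation (tree_measure N e) (path_sum N v (\<lambda>w. 1 / (f w * c w)))
      * (f v * prob_space.expectation (tree_measure N e) (subtree_sum N v c)))"
    and u_nonneg: "\<And>v. v \<in> nodes N \<Longrightarrow> u v \<ge> 0"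
    and u_root: "u (1, 0) = 1" "u (0, 1) = 1"
  shows "(\<Sum>(r, s) \<in> {(r, s). 2 \<le> r + s \<and> r + s \<le> N}. c (r, s) * Psi (u (r, s)))
    \<le> 4 * K * (\<Sum>(r, s) \<in> {(r, s). 2 \<le> r + s \<and> r + s \<le> N}. c (r, s) *
        (w_left e r s / (w_left e r s + w_down e r s)
           * (sqrt (Psi (u (r, s))) - sqrt (Psi (u (r - 1, s))))\<^sup>2
         + w_down e r s / (w_left e r s + w_down e r s)
           * (sqrt (Psi (u (r, s))) - sqrt (Psi (u (r, s - 1))))\<^sup>2))"
proof -
  interpret positive_weights N e
    using e_pos by unfold_locales
  define V where "V = inner_nodes N"
  define P where "P = parent_prob"
  define E where "E v g = integral\<^sup>L (tree_measure N e) (path_sum N v g)" for v g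
  define x where "x v = sqrt (Psi (u v))" for v
  \<comment> \<open>The sum runs over all parents, including those of level 1, since increments from
    the root count on the right-hand side.\<close>
  define D where "D v = (\<Sum>w \<in> nodes N. P v w * (x v - x w)\<^sup>2)" for v
  have V_nodes: "V \<subseteq> nodes N" by (auto simp: V_def inner_nodes_def)
  have P: "0 \<le> P v w" for v w
    unfolding P_def by (rule parent_prob_nonneg)
  interpret green_kernel V level P "\<lambda>v w. E v (\<lambda>x. of_bool (x = w))"
    unfolding V_def P_def E_def by (rule green_kernel_tree)

  have x_square: "(x v)\<^sup>2 = Psi (u v)" if "v \<in> V" for v
    using Psi_nonneg[OF u_nonneg[OF subsetD[OF V_nodes that]]] by (simp add: x_def)
  \<comment> \<open>The boundary condition enters here: \<open>Psi 1 = 0\<close>.\<close>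
  have x_root: "x v = 0" if v: "level v = 1" for v
  proof -
    have "v = (1, 0) \<or> v = (0, 1)" using v by (cases v) (auto simp: level_def add_is_1)
    then show ?thesis using u_root by (auto simp: x_def Psi_def)
  qed

  have "(\<Sum>v\<in>V. c v * (x v)\<^sup>2) \<le> 4 * K * (\<Sum>v\<in>V. c v * D v)"
  proof (rule hardy_inequality[where f = f and S = "\<lambda>v. E v (\<lambda>w. 1 / (f w * c w))"
        and M = "\<lambda>v. integral\<^sup>L (tree_measure N e) (subtree_sum N v c)"])
    fix v assume v: "v \<in> V"
    then have v_node: "v \<in> nodes N" using V_nodes by auto
    obtain r s where rs: "v = (r, s)" by fastforce
    then have rs_le: "2 \<le> r + s" "r + s \<le> N"
      using v by (auto simp: V_def inner_nodes_eq)
    show "0 < f v" "0 < c v" using v_node f_pos c_pos by auto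
    show "(\<Sum>z\<in>V. P z v / f z) \<le> 1 / f v"
    proof (cases "r + s < N")
      case True
      then show ?thesis
        using f_rec[of r s] sum_child_eq[of r s "\<lambda>z. 1 / f z"] rs_le
        unfolding V_def P_def rs by simp
    next
      \<comment> \<open>On the last level \<open>f\<close> satisfies no recursion, but the sum over
        children is empty and \<open>1 / f\<close> is positive.\<close>
      case False
      then show ?thesis
        using sum_child_last[of v "\<lambda>z. 1 / f z"] f_pos[OF v_node]
        by (simp add: V_def P_def rs level_def)
    qed
    show "E v (\<lambda>w. 1 / (f w * c w)) = 1 / (f v * c v) + (\<Sum>w\<in>V. P v w * E w (\<lambda>w. 1 / (f w * c w)))"
      using mean_path_sum_parent[of v] v by (simp add: V_def P_def E_def)
    show "integral\<^sup>L (tree_measure N e) (subtree_sum N v c) = (\<Sum>w\<in>V. c w * E w (\<lambda>x. of_bool (x = v)))"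
      using mean_subtree_sum[of v c] v by (simp add: V_def E_def)
    show "E v (\<lambda>w. 1 / (f w * c w)) * (f v * integral\<^sup>L (tree_measure N e) (subtree_sum N v c)) \<le> K"
      unfolding K_def E_def using v_node by (intro cSUP_upper) auto
    show "0 \<le> D v"
      unfolding D_def using P by (intro sum_nonneg mult_nonneg_nonneg) auto
    have P1: "(\<Sum>w \<in> nodes N. P v w) = 1"
      using sum_parent_prob_1[of v] v by (simp add: V_def P_def)
    \<comment> \<open>Over all nodes the row has mass 1, so \<open>x v\<close> is compared with each
      parent by the triangle inequality. Cauchy-Schwarz turns the mean increment into
      \<open>sqrt (D v)\<close>, and the parents of level 1 vanish by \<open>x_root\<close>.\<close>
    have "\<bar>x v\<bar> = (\<Sum>w \<in> nodes N. P v w * \<bar>x v\<bar>)"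
      unfolding sum_distrib_right[symmetric] by (simp add: P1)
    also have "\<dots> \<le> (\<Sum>w \<in> nodes N. P v w * sqrt (1 * (x v - x w)\<^sup>2) + P v w * \<bar>x w\<bar>)"
      unfolding distrib_left[symmetric] using P by (intro sum_mono mult_left_mono) auto
    also have "\<dots> = (\<Sum>w \<in> nodes N. P v w * sqrt (1 * (x v - x w)\<^sup>2)) + (\<Sum>w \<in> nodes N. P v w * \<bar>x w\<bar>)"
      by (rule sum.distrib)
    also have "(\<Sum>w \<in> nodes N. P v w * sqrt (1 * (x v - x w)\<^sup>2)) \<le> sqrt ((\<Sum>w \<in> nodes N. P v w * 1) * D v)"
      unfolding D_def using P by (intro sum_mult_sqrt_le) auto
    also have "(\<Sum>w \<in> nodes N. P v w * \<bar>x w\<bar>) = (\<Sum>w\<in>V. P v w * \<bar>x w\<bar>)"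
      unfolding P_def V_def using x_root by (intro sum_parent_prob_inner) auto
    finally show "\<bar>x v\<bar> \<le> sqrt (D v) + (\<Sum>w\<in>V. P v w * \<bar>x w\<bar>)"
      by (simp add: P1)
  qed
  also have "(\<Sum>v\<in>V. c v * (x v)\<^sup>2) = (\<Sum>(r, s) \<in> {(r, s). 2 \<le> r + s \<and> r + s \<le> N}. c (r, s) * Psi (u (r, s)))"
    using x_square unfolding V_def inner_nodes_eq by (intro sum.cong) auto
  also have "(\<Sum>v\<in>V. c v * D v) = (\<Sum>(r, s) \<in> {(r, s). 2 \<le> r + s \<and> r + s \<le> N}. c (r, s) *
        (w_left e r s / (w_left e r s + w_down e r s)
           * (sqrt (Psi (u (r, s))) - sqrt (Psi (u (r - 1, s))))\<^sup>2
         + w_down e r s / (w_left e r s + w_down e r s)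
           * (sqrt (Psi (u (r, s))) - sqrt (Psi (u (r, s - 1))))\<^sup>2))"
    unfolding V_def inner_nodes_eq D_def P_def
    by (intro sum.cong refl) (clarsimp simp: sum_parent_prob_eq x_def)
  finally show ?thesis .
qed

end
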